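(* Let $G=(X,Y,E)$ be a connected simple $n$-vertex $d$-regular bipartite graph, with adjacency eigenvalues $d=\lambda_1\ge\lambda_2\ge\cdots\ge\lambda_n=-d$ and corresponding eigenvectors ${\bf u}_1,\ldots,{\bf u}_n$ forming an orthonormal basis of $\mathbb R^n$. Define $\lambda^*_1=n/2-d$, $\lambda^*_n=-n/2+d$, and $\lambda^*_i=-\lambda_i$ for $i\ne1,n$. Let $k\ge1$, $1\le t\le k$, and let $\mathcal B$ be the set of vectors ${\bf b}\in\{-1,1\}^k$ having at least $t$ entries equal to $1$. Then the spectrum of (the adjacency matrix of) $SGP_{k,t}(G)$ consists of the eigenvalues $$\Lambda_{i_1i_2\cdots i_k}=\sum_{{\bf b}\in\mathcal B}\prod_{j=1}^k\left(\frac{1+b_j}{2}\lambda_{i_j}+\frac{1-b_j}{2}\lambda^*_{i_j}\right),\qquad i_1,\ldots,i_k\in\{1,\ldots,n\},$$ with corresponding eigenvectors ${\bf w}_{i_1\cdots i_k}={\bf u}_{i_1}\otimes{\bf u}_{i_2}\otimes\cdots\otimes{\bf u}_{i_k}$ (where vertices of $SGP_{k,t}(G)$ are indexed consistently with the Kronecker product of the indexing of $V(G)$).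
   Context: For a simple bipartite graph $G=(X,Y,E)$, the template of $(a_1,\ldots,a_k)\in(X\cup Y)^k$ is the string $\tau\in\{\mathcal X,\mathcal Y\}^k$ with $\tau_i=\mathcal X$ iff $a_i\in X$; the complement of a template swaps $\mathcal X$ and $\mathcal Y$. The shuffled bipartite graph product $SGP_{k,t}(G)$ is the graph with vertex set $(X\cup Y)^k$ in which $(a_1,\ldots,a_k)$ and $(b_1,\ldots,b_k)$ are adjacent iff their templates are complements of each other and there are at least $t$ indices $i$ with $\{a_i,b_i\}\in E$. *)

theory Defs
  imports
    "HOL-Computational_Algebra.Polynomial"
    "Jordan_Normal_Form.Spectral_Radius"
begin

definition bipartite_graph :: "'a set \<Rightarrow> 'a set \<Rightarrow> 'a set set \<Rightarrow> bool" where
  "bipartite_graph X Y E \<longleftrightarrow>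
     finite X \<and> finite Y \<and> X \<inter> Y = {} \<and> E \<subseteq> {{x, y} | x y. x \<in> X \<and> y \<in> Y}"

(* The empty graph does not count as connected. *)
definition connected_graph :: "'a set \<Rightarrow> 'a set set \<Rightarrow> bool" where
  "connected_graph V E \<longleftrightarrow>
     V \<noteq> {} \<and> (\<forall>u\<in>V. \<forall>v\<in>V. (u, v) \<in> {(a, b). a \<in> V \<and> b \<in> V \<and> {a, b} \<in> E}\<^sup>*)"

definition regular_graph :: "'a set \<Rightarrow> 'a set set \<Rightarrow> nat \<Rightarrow> bool" where
  "regular_graph V E d \<longleftrightarrow> (\<forall>v\<in>V. card {w \<in> V. {v, w} \<in> E} = d)"

(* The list vs enumerates the vertices and fixes the row and column order. *)
definition adjacency_mat :: "'a list \<Rightarrow> 'a set set \<Rightarrow> real mat" where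
  "adjacency_mat vs E =
     mat (length vs) (length vs) (\<lambda>(i, j). if {vs ! i, vs ! j} \<in> E then 1 else 0)"

datatype side = SideX | SideY

fun opposite :: "side \<Rightarrow> side" where
  "opposite SideX = SideY"
| "opposite SideY = SideX"

definition template :: "'a set \<Rightarrow> 'a list \<Rightarrow> side list" where
  "template X a = map (\<lambda>v. if v \<in> X then SideX else SideY) a"

definition complement_template :: "side list \<Rightarrow> side list" where
  "complement_template \<tau> = map opposite \<tau>"

definition SGP_verts :: "'a set \<Rightarrow> 'a set \<Rightarrow> nat \<Rightarrow> 'a list set" where
  "SGP_verts X Y k = {a. length a = k \<and> set a \<subseteq> X \<union> Y}"

definition SGP_edges :: "'a set \<Rightarrow> 'a set \<Rightarrow> 'a set set \<Rightarrow> nat \<Rightarrow> nat \<Rightarrow> 'a list set set" where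
  "SGP_edges X Y E k t =
     {{a, b} | a b. a \<in> SGP_verts X Y k \<and> b \<in> SGP_verts X Y k \<and>
        template X b = complement_template (template X a) \<and>
        card {i. i < k \<and> {a ! i, b ! i} \<in> E} \<ge> t}"

(* The k-tuples over vs in lexicographic order, first coordinate most significant.
   This is the index order of the Kronecker product below. *)
definition tuple_list :: "nat \<Rightarrow> 'a list \<Rightarrow> 'a list list" where
  "tuple_list k vs = product_lists (replicate k vs)"

lemma set_tuple_list:
  "set (tuple_list k vs) = {a. length a = k \<and> set a \<subseteq> set vs}"
proof -
  have "list_all2 (\<lambda>x ys. x \<in> set ys) a (replicate k vs) \<longleftrightarrow> length a = k \<and> set a \<subseteq> set vs" for a
    by (fastforce simp: list_all2_conv_all_nth in_set_conv_nth[of _ a])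
  then show ?thesis
    by (simp add: tuple_list_def product_lists_set)
qed

definition kron_vec :: "real vec \<Rightarrow> real vec \<Rightarrow> real vec" (infixr "\<otimes>\<^sub>v" 70) where
  "u \<otimes>\<^sub>v v = vec (dim_vec u * dim_vec v) (\<lambda>i. u $ (i div dim_vec v) * v $ (i mod dim_vec v))"

(* The empty product is the vector (1) of dimension one, which is neutral for kron_vec. *)
definition kron_vecs :: "real vec list \<Rightarrow> real vec" where
  "kron_vecs us = foldr (\<otimes>\<^sub>v) us (vec 1 (\<lambda>_. 1))"

definition orthonormal_basis :: "nat \<Rightarrow> (nat \<Rightarrow> real vec) \<Rightarrow> bool" where
  "orthonormal_basis n u \<longleftrightarrow>
     vectorspace.basis class_ring (module_vec TYPE(real) n) (u ` {1..n}) \<and>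
     (\<forall>i\<in>{1..n}. \<forall>j\<in>{1..n}. u i \<bullet> u j = (if i = j then 1 else 0))"

(* Eigenvalues with algebraic multiplicity; non-real roots of the characteristic
   polynomial would be missing, but the adjacency matrices used here are symmetric. *)
definition spectrum_mset :: "real mat \<Rightarrow> real multiset" where
  "spectrum_mset A = proots (char_poly A)"

lemma set_spectrum_mset:
  assumes "A \<in> carrier_mat n n"
  shows "set_mset (spectrum_mset A) = spectrum A"
proof -
  have "char_poly A \<noteq> 0"
    using degree_monic_char_poly[OF assms] by auto
  then show ?thesis
    by (simp add: spectrum_mset_def spectrum_root_char_poly[OF assms])
qed

(* For n = 1 the first two cases overlap; the first one is then used. *)
definition lambda_star :: "nat \<Rightarrow> nat \<Rightarrow> (nat \<Rightarrow> real) \<Rightarrow> nat \<Rightarrow> real" where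
  "lambda_star n d lam i =
     (if i = 1 then real n / 2 - real d
      else if i = n then - real n / 2 + real d
      else - lam i)"

definition sign_vectors :: "nat \<Rightarrow> nat \<Rightarrow> real list set" where
  "sign_vectors k t =
     {b. length b = k \<and> set b \<subseteq> {-1, 1} \<and> card {j. j < k \<and> b ! j = 1} \<ge> t}"

definition Lambda :: "nat \<Rightarrow> nat \<Rightarrow> nat \<Rightarrow> nat \<Rightarrow> (nat \<Rightarrow> real) \<Rightarrow> nat list \<Rightarrow> real" where
  "Lambda n d k t lam ix =
     (\<Sum>b\<in>sign_vectors k t. \<Prod>j<k.
        (1 + b ! j) / 2 * lam (ix ! j) + (1 - b ! j) / 2 * lambda_star n d lam (ix ! j))"

definition index_tuples :: "nat \<Rightarrow> nat \<Rightarrow> nat list set" where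
  "index_tuples n k = {ix. length ix = k \<and> set ix \<subseteq> {1..n}}"

end

theory Submission
  imports Defs
begin

text \<open>Let \<open>A\<close> be the adjacency matrix of the graph and \<open>K\<close> that of the complete bipartite graph on the
  same sides. The adjacency matrix of the shuffled product is the sum over the admissible sign
  vectors of the Kronecker products of factors \<open>A\<close> (for a sign 1) and \<open>K - A\<close> (for a sign -1). By
  connectedness the eigenfunctions for \<open>d\<close> and \<open>- d\<close> are the constants and the multiples of the
  side signs, so every other basis vector is annihilated by \<open>K\<close>; thus the given basis
  diagonalises \<open>A\<close> and \<open>K - A\<close> simultaneously. Vectors are treated as functions on vertices, which
  makes a Kronecker product of vectors a product of functions on tuples.\<close>

section \<open>Vectors as functions on vertices\<close>

text \<open>Turns scalar products and matrix-vector products into sums over a vertex set, where the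
  enumeration order no longer matters.\<close>

definition vec_on :: "'a list \<Rightarrow> ('a \<Rightarrow> real) \<Rightarrow> real vec" where
  "vec_on vs f = vec (length vs) (\<lambda>l. f (vs ! l))"

lemma dim_vec_on [simp]: "dim_vec (vec_on vs f) = length vs"
  by (simp add: vec_on_def)

lemma vec_on_carrier [simp]: "vec_on vs f \<in> carrier_vec (length vs)"
  by (simp add: carrier_vecI)

lemma index_vec_on [simp]: "l < length vs \<Longrightarrow> vec_on vs f $ l = f (vs ! l)"
  by (simp add: vec_on_def)

lemma vec_on_cong: "(\<And>v. v \<in> set vs \<Longrightarrow> f v = g v) \<Longrightarrow> vec_on vs f = vec_on vs g"
  by (auto intro!: eq_vecI)

lemma vec_on_eq_iff: "vec_on vs f = vec_on vs g \<longleftrightarrow> (\<forall>v\<in>set vs. f v = g v)"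
  by (simp add: vec_eq_iff all_set_conv_all_nth)

lemma smult_vec_on: "c \<cdot>\<^sub>v vec_on vs f = vec_on vs (\<lambda>v. c * f v)"
  by (auto intro!: eq_vecI)

text \<open>Without repetitions in \<open>vs\<close>, a vertex determines its position, so the
  coordinates can be read back as values at vertices. This is how the given eigenvectors become
  functions.\<close>

lemma vec_on_exhaust:
  assumes "distinct vs" "w \<in> carrier_vec (length vs)"
  obtains f where "w = vec_on vs f"
proof
  show "w = vec_on vs (\<lambda>v. w $ the_inv_into {..<length vs} ((!) vs) v)"
    using assms by (auto intro!: eq_vecI simp: the_inv_into_f_f inj_on_nth)
qed

lemma sum_nth_distinct:
  assumes "distinct vs"
  shows "(\<Sum>l<length vs. f (vs ! l)) = (\<Sum>v\<in>set vs. f v)"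
  by (rule sum.reindex_bij_betw[OF bij_betw_nth[OF assms refl refl]])

lemma scalar_prod_vec_on:
  assumes "distinct vs"
  shows "vec_on vs f \<bullet> vec_on vs g = (\<Sum>v\<in>set vs. f v * g v)"
  using sum_nth_distinct[OF assms, of "\<lambda>v. f v * g v"]
  by (simp add: scalar_prod_def atLeast0LessThan)

lemma adjacency_mat_carrier: "adjacency_mat vs E \<in> carrier_mat (length vs) (length vs)"
  by (simp add: adjacency_mat_def)

lemma adjacency_mat_mult_vec_on:
  assumes "distinct vs"
  shows "adjacency_mat vs E *\<^sub>v vec_on vs f =
    vec_on vs (\<lambda>v. \<Sum>w\<in>set vs. of_bool ({v, w} \<in> E) * f w)"
proof (rule eq_vecI)
  fix l assume "l < dim_vec (vec_on vs (\<lambda>v. \<Sum>w\<in>set vs. of_bool ({v, w} \<in> E) * f w))"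
  then have l: "l < length vs" by simp
  then have "(adjacency_mat vs E *\<^sub>v vec_on vs f) $ l =
      (\<Sum>m<length vs. of_bool ({vs ! l, vs ! m} \<in> E) * f (vs ! m))"
    by (simp add: adjacency_mat_def scalar_prod_def atLeast0LessThan of_bool_def)
  also have "\<dots> = (\<Sum>w\<in>set vs. of_bool ({vs ! l, w} \<in> E) * f w)"
    by (rule sum_nth_distinct[OF assms])
  finally show "(adjacency_mat vs E *\<^sub>v vec_on vs f) $ l =
      vec_on vs (\<lambda>v. \<Sum>w\<in>set vs. of_bool ({v, w} \<in> E) * f w) $ l"
    using l by simp
qed (simp add: adjacency_mat_def)

lemma eigenvector_vec_on_iff:
  assumes "distinct vs"
  shows "eigenvector (adjacency_mat vs E) (vec_on vs f) c \<longleftrightarrow>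
    (\<exists>v\<in>set vs. f v \<noteq> 0) \<and>
    (\<forall>v\<in>set vs. (\<Sum>w\<in>set vs. of_bool ({v, w} \<in> E) * f w) = c * f v)"
proof -
  have "vec_on vs f = 0\<^sub>v (length vs) \<longleftrightarrow> (\<forall>v\<in>set vs. f v = 0)"
    by (simp add: vec_eq_iff all_set_conv_all_nth)
  then show ?thesis
    unfolding eigenvector_def adjacency_mat_mult_vec_on[OF assms] smult_vec_on vec_on_eq_iff
    by (simp add: adjacency_mat_def)
qed

section \<open>Tuples and Kronecker products\<close>

lemma tuple_list_0 [simp]: "tuple_list 0 vs = [[]]"
  by (simp add: tuple_list_def)

lemma tuple_list_Suc:
  "tuple_list (Suc k) vs = concat (map (\<lambda>x. map (Cons x) (tuple_list k vs)) vs)"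
  by (simp add: tuple_list_def)

lemma distinct_tuple_list: "distinct vs \<Longrightarrow> distinct (tuple_list k vs)"
  unfolding tuple_list_def by (rule distinct_product_lists) auto

lemma length_concat_map_Cons:
  "length (concat (map (\<lambda>x. map (Cons x) P) vs)) = length vs * length P"
  by (induction vs) auto

lemma length_tuple_list: "length (tuple_list k vs) = length vs ^ k"
  by (induction k) (auto simp: tuple_list_Suc length_concat_map_Cons)

text \<open>Each \<open>x\<close> contributes a block of length \<open>length P\<close>. The
  quotient and remainder are those in \<open>kron_vec\<close>, which is why lexicographic order fits
  the Kronecker product.\<close>

lemma nth_concat_map_Cons:
  "l < length vs * length P \<Longrightarrow>
    concat (map (\<lambda>x. map (Cons x) P) vs) ! l = vs ! (l div length P) # P ! (l mod length P)"
proof (induction vs arbitrary: l)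
  case (Cons x vs)
  then have P: "length P > 0" by (cases P) auto
  show ?case
  proof (cases "l < length P")
    case False
    then have "l - length P < length vs * length P"
      using Cons.prems by auto
    with False P Cons.IH[of "l - length P"] show ?thesis
      by (simp add: nth_append le_div_geq le_mod_geq)
  qed (simp add: nth_append)
qed simp

lemma kron_vecs_vec_on:
  "kron_vecs (map (vec_on vs) fs) =
    vec_on (tuple_list (length fs) vs) (\<lambda>a. \<Prod>j<length fs. (fs ! j) (a ! j))"
proof (induction fs)
  case Nil
  then show ?case by (auto simp: kron_vecs_def intro!: eq_vecI)
next
  case (Cons f fs)
  let ?T = "tuple_list (length fs) vs"
  let ?w = "vec_on ?T (\<lambda>a. \<Prod>j<length fs. (fs ! j) (a ! j))"
  have eq: "kron_vecs (map (vec_on vs) (f # fs)) = vec_on vs f \<otimes>\<^sub>v ?w"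
    using Cons.IH by (simp add: kron_vecs_def)
  show ?case unfolding eq
  proof (rule eq_vecI)
    fix l
    assume "l < dim_vec (vec_on (tuple_list (length (f # fs)) vs)
      (\<lambda>a. \<Prod>j<length (f # fs). ((f # fs) ! j) (a ! j)))"
    then have l: "l < length vs * length ?T"
      by (simp add: length_tuple_list)
    then have "length ?T > 0" by (cases "length ?T") auto
    with l have "l div length ?T < length vs" "l mod length ?T < length ?T"
      by (auto simp: less_mult_imp_div_less)
    with l show "(vec_on vs f \<otimes>\<^sub>v ?w) $ l = vec_on (tuple_list (length (f # fs)) vs)
      (\<lambda>a. \<Prod>j<length (f # fs). ((f # fs) ! j) (a ! j)) $ l"
      by (simp add: kron_vec_def tuple_list_Suc length_concat_map_Cons nth_concat_map_Cons
          prod.lessThan_Suc_shift del: prod.lessThan_Suc)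
  qed (simp add: kron_vec_def length_tuple_list)
qed

text \<open>Generalised distributivity, by splitting off the first coordinate. The induction varies
  \<open>g\<close> because the remaining factors are shifted by one.\<close>

lemma sum_tuples_prod:
  fixes g :: "nat \<Rightarrow> 'a \<Rightarrow> real"
  assumes "finite S"
  shows "(\<Sum>a | length a = k \<and> set a \<subseteq> S. \<Prod>j<k. g j (a ! j)) = (\<Prod>j<k. \<Sum>x\<in>S. g j x)"
proof (induction k arbitrary: g)
  case (Suc k)
  let ?L = "\<lambda>k. {a. length a = k \<and> set a \<subseteq> S}"
  have bij: "bij_betw (\<lambda>(x, a). x # a) (S \<times> ?L k) (?L (Suc k))"
    by (auto simp: bij_betw_def inj_on_def image_def length_Suc_conv)
  have "(\<Sum>a\<in>?L (Suc k). \<Prod>j<Suc k. g j (a ! j)) =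
      (\<Sum>(x, a)\<in>S \<times> ?L k. g 0 x * (\<Prod>j<k. g (Suc j) (a ! j)))"
    by (subst sum.reindex_bij_betw[OF bij, symmetric])
      (auto simp: prod.lessThan_Suc_shift case_prod_beta simp del: prod.lessThan_Suc intro!: sum.cong)
  also have "\<dots> = (\<Sum>x\<in>S. g 0 x) * (\<Sum>a\<in>?L k. \<Prod>j<k. g (Suc j) (a ! j))"
    by (simp add: sum.cartesian_product[symmetric] sum_product)
  finally show ?case
    by (simp add: Suc.IH[of "\<lambda>j. g (Suc j)"] prod.lessThan_Suc_shift del: prod.lessThan_Suc)
qed (simp add: Collect_conv_if cong: conj_cong)

section \<open>Spectrum from an orthonormal eigenbasis\<close>

text \<open>There are as many eigenvectors as dimensions, so the matrix with these columns is
  orthogonal and conjugates \<open>A\<close> to a diagonal matrix. The characteristic polynomial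
  then splits, with the multiplicities given by \<open>xs\<close>.\<close>

lemma spectrum_mset_orthonormal_eigenvectors:
  fixes A :: "real mat"
  assumes A: "A \<in> carrier_mat (length xs) (length xs)"
    and eig: "\<And>x. x \<in> set xs \<Longrightarrow> eigenvector A (w x) (mu x)"
    and orth: "\<And>x y. x \<in> set xs \<Longrightarrow> y \<in> set xs \<Longrightarrow> w x \<bullet> w y = (if x = y then 1 else 0)"
    and dist: "distinct xs"
  shows "spectrum_mset A = image_mset mu (mset xs)"
proof -
  let ?N = "length xs"
  let ?P = "mat_of_cols ?N (map w xs)"
  let ?D = "mat_diag ?N (\<lambda>l. mu (xs ! l))"
  have w: "w x \<in> carrier_vec ?N" "A *\<^sub>v w x = mu x \<cdot>\<^sub>v w x" if "x \<in> set xs" for x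
    using eig[OF that] A by (auto simp: eigenvector_def)
  have P: "?P \<in> carrier_mat ?N ?N"
    using mat_of_cols_carrier(1)[of ?N "map w xs"] by simp
  have col: "col ?P l = w (xs ! l)" if "l < ?N" for l
    using that w by simp
  \<comment> \<open>The entries of this Gram matrix are the scalar products of the
    eigenvectors.\<close>
  have PP: "?P\<^sup>T * ?P = 1\<^sub>m ?N"
    using P dist by (auto intro!: eq_matI simp: row_transpose col orth nth_eq_iff_index_eq
        simp del: col_mat_of_cols)
  then have PP': "?P * ?P\<^sup>T = 1\<^sub>m ?N"
    using P by (intro mat_mult_left_right_inverse[of "?P\<^sup>T"]) auto
  have AP: "A * ?P = ?P * ?D"
  proof (rule eq_matI)
    fix i j assume "i < dim_row (?P * ?D)" "j < dim_col (?P * ?D)"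
    then have i: "i < ?N" and j: "j < ?N" by (auto simp: mat_diag_def)
    have "(A * ?P) $$ (i, j) = (A *\<^sub>v w (xs ! j)) $ i"
      using A P i j by (simp add: col del: col_mat_of_cols)
    also have "\<dots> = (?P * ?D) $$ (i, j)"
      using w[of "xs ! j"] i j by (subst mat_diag_mult_right[OF P]) (simp add: mat_of_cols_index)
    finally show "(A * ?P) $$ (i, j) = (?P * ?D) $$ (i, j)" .
  qed (use A P in \<open>auto simp: mat_diag_def\<close>)
  have "A = A * (?P * ?P\<^sup>T)" using A PP' by simp
  also have "\<dots> = ?P * ?D * ?P\<^sup>T"
    using A P by (simp add: AP[symmetric] assoc_mult_mat[of _ ?N ?N _ ?N _ ?N])
  finally have "similar_mat A ?D"
    using A P PP PP' by (intro similar_matI[of _ _ ?P "?P\<^sup>T" ?N]) auto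
  then have "char_poly A = (\<Prod>a\<leftarrow>diag_mat ?D. [:- a, 1:])"
    using char_poly_similar[of A ?D] char_poly_upper_triangular[of ?D ?N]
    by (simp add: upper_triangular_def mat_diag_def)
  also have "diag_mat ?D = map mu xs"
    by (rule nth_equalityI) (simp_all add: diag_mat_def mat_diag_def)
  finally have cp: "char_poly A = (\<Prod>x\<leftarrow>xs. [:- mu x, 1:])" by (simp add: o_def)
  \<comment> \<open>Generalised to any list \<open>ys\<close> for the induction, since the length of
    \<open>xs\<close> is tied to the dimension of \<open>A\<close>.\<close>
  have "proots (\<Prod>x\<leftarrow>ys. [:- mu x, 1:]) = image_mset mu (mset ys)" for ys
  proof (induction ys)
    case (Cons y ys)
    have "(\<Prod>x\<leftarrow>ys. [:- mu x, 1:]) \<noteq> 0"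
      by auto
    then have "proots ([:- mu y, 1:] * (\<Prod>x\<leftarrow>ys. [:- mu x, 1:])) =
        proots [:- mu y, 1:] + proots (\<Prod>x\<leftarrow>ys. [:- mu x, 1:])"
      by (intro proots_mult) auto
    with Cons.IH show ?case by (simp del: mult_pCons_left)
  qed simp
  then show ?thesis by (simp add: spectrum_mset_def cp)
qed

section \<open>Eigenfunctions of the base graph\<close>

text \<open>Maximum principle: where \<open>f\<close> is maximal, the eigenvalue equation forces
  every neighbour to be maximal too, and connectedness spreads this to all vertices.\<close>

lemma eigenfunction_degree_constant:
  fixes f :: "'a \<Rightarrow> real"
  assumes "finite V" and conn: "connected_graph V E" and reg: "regular_graph V E d"
    and eig: "\<And>v. v \<in> V \<Longrightarrow> (\<Sum>w\<in>V. of_bool ({v, w} \<in> E) * f w) = real d * f v"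
  obtains c where "\<And>v. v \<in> V \<Longrightarrow> f v = c"
proof -
  let ?m = "Max (f ` V)"
  have "V \<noteq> {}" using conn by (simp add: connected_graph_def)
  then have "?m \<in> f ` V" using \<open>finite V\<close> by (intro Max_in) auto
  then obtain r where r: "r \<in> V" "f r = ?m" by (metis imageE)
  have le: "f w \<le> ?m" if "w \<in> V" for w
    using that \<open>finite V\<close> by simp
  have step: "f w = ?m" if "v \<in> V" "w \<in> V" "{v, w} \<in> E" "f v = ?m" for v w
  proof -
    have "(\<Sum>w\<in>V. of_bool ({v, w} \<in> E)) = real d"
      using reg \<open>v \<in> V\<close> \<open>finite V\<close> by (simp add: regular_graph_def sum.If_cases of_bool_def Int_def)
    \<comment> \<open>Subtracting the eigenvalue equation from \<open>?m\<close> times the degree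
      leaves a vanishing sum of nonnegative terms, so each term is zero.\<close>
    then have "(\<Sum>w\<in>V. of_bool ({v, w} \<in> E) * (?m - f w)) = 0"
      using eig[OF \<open>v \<in> V\<close>] \<open>f v = ?m\<close>
      by (simp add: right_diff_distrib sum_subtractf sum_distrib_right[symmetric])
    then have "of_bool ({v, w} \<in> E) * (?m - f w) = 0"
      using \<open>finite V\<close> \<open>w \<in> V\<close> le by (subst (asm) sum_nonneg_eq_0_iff) auto
    with that show ?thesis by simp
  qed
  have "f v = ?m" if "v \<in> V" for v
  proof -
    have "(r, v) \<in> {(a, b). a \<in> V \<and> b \<in> V \<and> {a, b} \<in> E}\<^sup>*"
      using conn r that by (simp add: connected_graph_def)
    then show ?thesis
      by (induction rule: rtrancl_induct) (use r step in auto)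
  qed
  then show thesis by (rule that)
qed

lemma bipartite_edge_sides:
  assumes "bipartite_graph X Y E" "{v, w} \<in> E"
  shows "v \<in> X \<longleftrightarrow> w \<notin> X"
  using assms by (auto simp: bipartite_graph_def doubleton_eq_iff dest!: subsetD)

text \<open>In a \<open>d\<close>-regular bipartite graph this is an eigenfunction for
  \<open>- d\<close>.\<close>

definition side_sign :: "'a set \<Rightarrow> 'a \<Rightarrow> real" where
  "side_sign X v = (if v \<in> X then 1 else -1)"

lemma side_sign_square [simp]: "side_sign X v * side_sign X v = 1"
  by (simp add: side_sign_def)

lemma of_bool_opposite_sides:
  "of_bool ((v \<in> X) \<noteq> (w \<in> X)) = (1 - side_sign X v * side_sign X w) / 2"
  by (simp add: side_sign_def)

text \<open>Multiplication by the side signs turns an eigenfunction for \<open>- d\<close> into one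
  for \<open>d\<close>, which is constant.\<close>

lemma eigenfunction_neg_degree_side_sign:
  fixes f :: "'a \<Rightarrow> real"
  assumes bip: "bipartite_graph X Y E" and conn: "connected_graph (X \<union> Y) E"
    and reg: "regular_graph (X \<union> Y) E d"
    and eig: "\<And>v. v \<in> X \<union> Y \<Longrightarrow>
      (\<Sum>w\<in>X \<union> Y. of_bool ({v, w} \<in> E) * f w) = - real d * f v"
  obtains c where "\<And>v. v \<in> X \<union> Y \<Longrightarrow> f v = c * side_sign X v"
proof -
  let ?s = "side_sign X"
  have "(\<Sum>w\<in>X \<union> Y. of_bool ({v, w} \<in> E) * (?s w * f w)) = real d * (?s v * f v)"
    if "v \<in> X \<union> Y" for v
  proof -
    \<comment> \<open>Only neighbours \<open>w\<close> of \<open>v\<close> contribute, and their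
      sign is opposite to that of \<open>v\<close>.\<close>
    have "(\<Sum>w\<in>X \<union> Y. of_bool ({v, w} \<in> E) * (?s w * f w)) =
        (\<Sum>w\<in>X \<union> Y. - ?s v * (of_bool ({v, w} \<in> E) * f w))"
      by (rule sum.cong) (use bipartite_edge_sides[OF bip, of v] in \<open>auto simp: side_sign_def\<close>)
    also have "\<dots> = real d * (?s v * f v)"
      unfolding sum_distrib_left[symmetric] eig[OF that] by simp
    finally show ?thesis .
  qed
  moreover have "finite (X \<union> Y)" using bip by (simp add: bipartite_graph_def)
  ultimately obtain c where c: "\<And>v. v \<in> X \<union> Y \<Longrightarrow> ?s v * f v = c"
    using eigenfunction_degree_constant[OF _ conn reg, of "\<lambda>v. ?s v * f v"] by blast
  have "f v = c * ?s v" if "v \<in> X \<union> Y" for v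
    using c[OF that] by (auto simp: side_sign_def split: if_splits)
  then show thesis by (rule that)
qed

text \<open>The matrix of the complete bipartite graph is half the difference of the all-ones matrix and
  the rank-one matrix of the side signs. Hence it acts on an orthonormal eigenbasis containing
  multiples of the constant and of the sign function without using that both sides have equal size.\<close>

lemma opposite_sides_sum_eigenfunction:
  fixes f :: "nat \<Rightarrow> 'a \<Rightarrow> real"
  assumes bip: "bipartite_graph X Y E" and conn: "connected_graph (X \<union> Y) E"
    and reg: "regular_graph (X \<union> Y) E d" and card: "card (X \<union> Y) = n" and "n \<noteq> 1"
    and lam: "lam 1 = real d" "lam n = - real d"
    and eig: "\<And>i v. i \<in> {1..n} \<Longrightarrow> v \<in> X \<union> Y \<Longrightarrow>
      (\<Sum>w\<in>X \<union> Y. of_bool ({v, w} \<in> E) * f i w) = lam i * f i v"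
    and orth: "\<And>i j. i \<in> {1..n} \<Longrightarrow> j \<in> {1..n} \<Longrightarrow>
      (\<Sum>v\<in>X \<union> Y. f i v * f j v) = (if i = j then 1 else 0)"
    and i: "i \<in> {1..n}" and v: "v \<in> X \<union> Y"
  shows "(\<Sum>w\<in>X \<union> Y. of_bool ((v \<in> X) \<noteq> (w \<in> X)) * f i w) =
    (lam i + lambda_star n d lam i) * f i v"
proof -
  let ?V = "X \<union> Y" and ?s = "side_sign X"
  have fin: "finite ?V" using bip by (simp add: bipartite_graph_def)
  have n: "1 \<in> {1..n}" "n \<in> {1..n}" using i by auto
  obtain c where c: "\<And>v. v \<in> ?V \<Longrightarrow> f 1 v = c"
    using eigenfunction_degree_constant[OF fin conn reg, of "f 1"] eig[OF n(1)] lam by auto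
  obtain c' where c': "\<And>v. v \<in> ?V \<Longrightarrow> f n v = c' * ?s v"
    using eigenfunction_neg_degree_side_sign[OF bip conn reg, of "f n"] eig[OF n(2)] lam by auto
  \<comment> \<open>Orthonormality against \<open>f 1 = c\<close> determines the sum of every
    \<open>f j\<close>; the next fact does the same for the signed sums. Taking \<open>j = 1\<close>
    and \<open>j = n\<close> shows that \<open>c\<close> and \<open>c'\<close> are nonzero.\<close>
  have c_sum: "c * (\<Sum>v\<in>?V. f j v) = (if j = 1 then 1 else 0)" if "j \<in> {1..n}" for j
    using orth[OF n(1) that] c by (auto simp: sum_distrib_left)
  have c'_sum: "c' * (\<Sum>v\<in>?V. ?s v * f j v) = (if j = n then 1 else 0)" if "j \<in> {1..n}" for j
    using orth[OF n(2) that] c' by (auto simp: sum_distrib_left mult.assoc)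
  have "c \<noteq> 0" "c' \<noteq> 0"
    using c_sum[OF n(1)] c'_sum[OF n(2)] by auto
  have "(\<Sum>w\<in>?V. of_bool ((v \<in> X) \<noteq> (w \<in> X)) * f i w) =
      ((\<Sum>w\<in>?V. f i w) - ?s v * (\<Sum>w\<in>?V. ?s w * f i w)) / 2"
    unfolding of_bool_opposite_sides
    by (simp add: sum_divide_distrib sum_subtractf sum_distrib_left algebra_simps diff_divide_distrib)
  also have "\<dots> = (lam i + lambda_star n d lam i) * f i v"
  proof -
    consider "i = 1" | "i = n" | "i \<noteq> 1" "i \<noteq> n" by blast
    then show ?thesis
    proof cases
      \<comment> \<open>Only the plain sum survives, giving \<open>n / 2\<close>, which equals
        \<open>lam 1 + lambda_star n d lam 1\<close>. In the case \<open>i = n\<close> only the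
        signed sum survives, giving \<open>- n / 2\<close>.\<close>
      case 1
      then have "(\<Sum>w\<in>?V. ?s w * f i w) = 0"
        using c'_sum[OF i] \<open>c' \<noteq> 0\<close> \<open>n \<noteq> 1\<close> by simp
      moreover have "(\<Sum>w\<in>?V. f i w) = real n * c"
        using 1 c card by simp
      ultimately show ?thesis
        using 1 c[OF v] lam by (simp add: lambda_star_def)
    next
      case 2
      then have "(\<Sum>w\<in>?V. f i w) = 0"
        using c_sum[OF i] \<open>c \<noteq> 0\<close> \<open>n \<noteq> 1\<close> by simp
      moreover have "(\<Sum>w\<in>?V. ?s w * f i w) = (\<Sum>w\<in>?V. c')"
        by (rule sum.cong) (use 2 c' in \<open>auto simp: mult.left_commute\<close>)
      ultimately show ?thesis
        using 2 c'[OF v] lam card \<open>n \<noteq> 1\<close> by (simp add: lambda_star_def)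
    next
      \<comment> \<open>Both sums vanish, and so does
        \<open>lam i + lambda_star n d lam i\<close>.\<close>
      case 3
      then show ?thesis
        using c_sum[OF i] c'_sum[OF i] \<open>c \<noteq> 0\<close> \<open>c' \<noteq> 0\<close> by (simp add: lambda_star_def)
    qed
  qed
  finally show ?thesis .
qed

section \<open>Adjacency in the shuffled product\<close>

lemma template_complement_iff:
  assumes "length a = length b"
  shows "template X b = complement_template (template X a) \<longleftrightarrow>
    (\<forall>j<length a. (a ! j \<in> X) \<noteq> (b ! j \<in> X))"
  using assms by (auto simp: template_def complement_template_def list_eq_iff_nth_eq)

text \<open>An edge is an unordered pair, so it may be presented in either order; the right-hand
  side is symmetric in \<open>a\<close> and \<open>b\<close>.\<close>

lemma SGP_edges_iff:
  assumes "a \<in> SGP_verts X Y k" "b \<in> SGP_verts X Y k"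
  shows "{a, b} \<in> SGP_edges X Y E k t \<longleftrightarrow>
    (\<forall>j<k. (a ! j \<in> X) \<noteq> (b ! j \<in> X)) \<and> t \<le> card {j. j < k \<and> {a ! j, b ! j} \<in> E}"
proof -
  let ?R = "\<lambda>a b. (\<forall>j<k. (a ! j \<in> X) \<noteq> (b ! j \<in> X)) \<and>
    t \<le> card {j. j < k \<and> {a ! j, b ! j} \<in> E}"
  have "template X b' = complement_template (template X a') \<longleftrightarrow>
      (\<forall>j<k. (a' ! j \<in> X) \<noteq> (b' ! j \<in> X))"
    if "a' \<in> SGP_verts X Y k" "b' \<in> SGP_verts X Y k" for a' b'
    using that by (simp add: template_complement_iff SGP_verts_def)
  then have "{a, b} \<in> SGP_edges X Y E k t \<longleftrightarrow>
    (\<exists>a' b'. {a, b} = {a', b'} \<and> a' \<in> SGP_verts X Y k \<and> b' \<in> SGP_verts X Y k \<and> ?R a' b')"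
    unfolding SGP_edges_def mem_Collect_eq by blast
  also have "\<dots> \<longleftrightarrow> ?R a b"
    using assms by (auto simp: doubleton_eq_iff insert_commute)
  finally show ?thesis .
qed

lemma finite_sign_vectors: "finite (sign_vectors k t)"
  by (rule finite_subset[OF _ finite_lists_length_eq[of "{-1, 1}" k]])
    (auto simp: sign_vectors_def)

text \<open>For complementary templates exactly one sign vector contributes: the one recording which
  coordinates are edges.\<close>

lemma SGP_edge_indicator:
  assumes bip: "bipartite_graph X Y E"
    and ab: "a \<in> SGP_verts X Y k" "b \<in> SGP_verts X Y k"
  shows "of_bool ({a, b} \<in> SGP_edges X Y E k t) =
    (\<Sum>\<sigma>\<in>sign_vectors k t. \<Prod>j<k.
      (1 + \<sigma> ! j) / 2 * of_bool ({a ! j, b ! j} \<in> E) +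
      (1 - \<sigma> ! j) / 2 * (of_bool ((a ! j \<in> X) \<noteq> (b ! j \<in> X)) - of_bool ({a ! j, b ! j} \<in> E)))"
  (is "_ = (\<Sum>\<sigma>\<in>_. \<Prod>j<k. ?M \<sigma> j)")
proof (cases "\<forall>j<k. (a ! j \<in> X) \<noteq> (b ! j \<in> X)")
  case True
  define \<tau> where "\<tau> = map (\<lambda>j. if {a ! j, b ! j} \<in> E then 1 else -1 :: real) [0..<k]"
  have "(\<Prod>j<k. ?M \<sigma> j) = of_bool (\<sigma> = \<tau>)" if "\<sigma> \<in> sign_vectors k t" for \<sigma>
  proof -
    have len: "length \<sigma> = k" and vals: "\<And>j. j < k \<Longrightarrow> \<sigma> ! j = -1 \<or> \<sigma> ! j = 1"
      using that nth_mem by (fastforce simp: sign_vectors_def)+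
    \<comment> \<open>The endpoints lie on opposite sides, so sign 1 selects the edge indicator and
      sign -1 the non-edge indicator.\<close>
    have M: "?M \<sigma> j = of_bool (\<sigma> ! j = \<tau> ! j)" if "j < k" for j
      using vals[OF that] True that by (auto simp: \<tau>_def)
    have "(\<Prod>j<k. ?M \<sigma> j) = (\<Prod>j<k. of_bool (\<sigma> ! j = \<tau> ! j))"
      by (rule prod.cong) (simp_all only: M lessThan_iff)
    also have "\<dots> = of_bool (\<sigma> = \<tau>)"
    proof (cases "\<sigma> = \<tau>")
      case False
      then obtain j where "j < k" "\<sigma> ! j \<noteq> \<tau> ! j"
        using len by (auto simp: list_eq_iff_nth_eq \<tau>_def)
      with False show ?thesis by (auto intro!: prod_zero)
    qed simp
    finally show ?thesis .
  qed
  then have "(\<Sum>\<sigma>\<in>sign_vectors k t. \<Prod>j<k. ?M \<sigma> j) = of_bool (\<tau> \<in> sign_vectors k t)"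
    using finite_sign_vectors[of k t] by (simp add: of_bool_def)
  also have "\<tau> \<in> sign_vectors k t \<longleftrightarrow> t \<le> card {j. j < k \<and> {a ! j, b ! j} \<in> E}"
  proof -
    have "{j. j < k \<and> \<tau> ! j = 1} = {j. j < k \<and> {a ! j, b ! j} \<in> E}"
      by (auto simp: \<tau>_def split: if_splits)
    then show ?thesis by (auto simp: sign_vectors_def \<tau>_def)
  qed
  finally show ?thesis
    using True by (simp add: SGP_edges_iff[OF ab])
next
  case False
  \<comment> \<open>A coordinate on one side is neither an edge of the graph nor of the complete
    bipartite graph, so its factor is zero for every sign vector.\<close>
  then obtain j where j: "j < k" "(a ! j \<in> X) = (b ! j \<in> X)" by blast
  with bipartite_edge_sides[OF bip] have "{a ! j, b ! j} \<notin> E" by blast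
  with j have "(\<Prod>j<k. ?M \<sigma> j) = 0" for \<sigma>
    by (intro prod_zero) auto
  with False show ?thesis
    by (simp add: SGP_edges_iff[OF ab])
qed

section \<open>Eigenvectors and spectrum of the shuffled product\<close>

theorem theorem11:
  fixes X Y :: "'a set" and E :: "'a set set" and vs :: "'a list"
    and n d k t :: nat and lam :: "nat \<Rightarrow> real" and u :: "nat \<Rightarrow> real vec"
  assumes "bipartite_graph X Y E"
    and "connected_graph (X \<union> Y) E"
    and "regular_graph (X \<union> Y) E d"
    and "card (X \<union> Y) = n"
    and "distinct vs" and "set vs = X \<union> Y"
    and "\<And>i j. 1 \<le> i \<Longrightarrow> i \<le> j \<Longrightarrow> j \<le> n \<Longrightarrow> lam j \<le> lam i"
    and "lam 1 = real d" and "lam n = - real d"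
    and "orthonormal_basis n u"
    and "\<And>i. i \<in> {1..n} \<Longrightarrow> eigenvector (adjacency_mat vs E) (u i) (lam i)"
    and "1 \<le> k" and "1 \<le> t" and "t \<le> k"
  shows "spectrum_mset (adjacency_mat (tuple_list k vs) (SGP_edges X Y E k t)) =
      image_mset (Lambda n d k t lam) (mset_set (index_tuples n k)) \<and>
    (\<forall>ix\<in>index_tuples n k.
      eigenvector (adjacency_mat (tuple_list k vs) (SGP_edges X Y E k t))
        (kron_vecs (map u ix)) (Lambda n d k t lam ix))"
proof -
  note bip = assms(1) and conn = assms(2) and reg = assms(3) and card = assms(4)
    and dist = assms(5) and set_vs = assms(6) and lam = assms(8,9)
  let ?V = "X \<union> Y" and ?L = "SGP_verts X Y k"
  have fin: "finite ?V" using bip by (simp add: bipartite_graph_def)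
  have len: "length vs = n" using card set_vs distinct_card[OF dist] by simp
  have set_L: "set (tuple_list k vs) = ?L"
    by (simp add: set_tuple_list SGP_verts_def set_vs)
  note dist_L = distinct_tuple_list[OF dist, of k]
  have "\<exists>f. u i = vec_on vs f" if "i \<in> {1..n}" for i
    using assms(11)[OF that] vec_on_exhaust[OF dist, of "u i"]
    by (auto simp: eigenvector_def adjacency_mat_def)
  then obtain f where f: "\<And>i. i \<in> {1..n} \<Longrightarrow> u i = vec_on vs (f i)"
    by metis
  have eig: "(\<Sum>w\<in>?V. of_bool ({v, w} \<in> E) * f i w) = lam i * f i v"
    if "i \<in> {1..n}" "v \<in> ?V" for i v
    using assms(11)[OF that(1)] that by (simp add: f eigenvector_vec_on_iff[OF dist] set_vs)
  have orth: "(\<Sum>v\<in>?V. f i v * f j v) = (if i = j then 1 else 0)"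
    if "i \<in> {1..n}" "j \<in> {1..n}" for i j
    using assms(10) that by (simp add: orthonormal_basis_def f scalar_prod_vec_on[OF dist] set_vs)
  \<comment> \<open>The Kronecker product of the eigenvectors, as a function on tuples.\<close>
  define F where "F ix a = (\<Prod>j<k. f (ix ! j) (a ! j))" for ix a
  define W where "W ix = vec_on (tuple_list k vs) (F ix)" for ix
  have W: "kron_vecs (map u ix) = W ix" if "ix \<in> index_tuples n k" for ix
  proof -
    have map_u: "map u ix = map (vec_on vs) (map f ix)"
      using that f by (auto simp: index_tuples_def)
    show ?thesis
      unfolding map_u kron_vecs_vec_on
      using that by (auto simp: index_tuples_def W_def F_def intro!: vec_on_cong)
  qed
  have ix_nth: "ix ! j \<in> {1..n}" if "ix \<in> index_tuples n k" "j < k" for ix j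
    using that nth_mem[of j ix] by (auto simp: index_tuples_def simp del: nth_mem)
  have W_orth: "W ix \<bullet> W iy = (if ix = iy then 1 else 0)"
    if "ix \<in> index_tuples n k" "iy \<in> index_tuples n k" for ix iy
  proof -
    \<comment> \<open>The scalar product factors over the coordinates, so orthonormality passes from
      the \<open>f i\<close> to the \<open>W ix\<close>.\<close>
    have "W ix \<bullet> W iy = (\<Sum>a\<in>?L. \<Prod>j<k. f (ix ! j) (a ! j) * f (iy ! j) (a ! j))"
      by (simp add: W_def scalar_prod_vec_on[OF dist_L] set_L F_def prod.distrib)
    also have "\<dots> = (\<Prod>j<k. \<Sum>v\<in>?V. f (ix ! j) v * f (iy ! j) v)"
      using sum_tuples_prod[OF fin, where k = k and g = "\<lambda>j v. f (ix ! j) v * f (iy ! j) v"]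
      by (simp add: SGP_verts_def)
    also have "\<dots> = (\<Prod>j<k. of_bool (ix ! j = iy ! j))"
      using orth[OF ix_nth[OF that(1)] ix_nth[OF that(2)]] by (intro prod.cong) auto
    also have "\<dots> = (if ix = iy then 1 else 0)"
    proof (cases "ix = iy")
      case False
      moreover have "length ix = k" "length iy = k"
        using that by (simp_all add: index_tuples_def)
      ultimately obtain j where "j < k" "ix ! j \<noteq> iy ! j"
        using nth_equalityI[of ix iy] by auto
      then show ?thesis using False by (auto intro!: prod_zero)
    qed simp
    finally show ?thesis .
  qed
  \<comment> \<open>Claimed for whole products rather than coordinatewise: with a single vertex, a
    coordinate with sign -1 violates the factor identity.\<close>
  have factors: "(\<Prod>j<k. \<Sum>v\<in>?V. ((1 + \<sigma> ! j) / 2 * of_bool ({a ! j, v} \<in> E) +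
        (1 - \<sigma> ! j) / 2 * (of_bool ((a ! j \<in> X) \<noteq> (v \<in> X)) - of_bool ({a ! j, v} \<in> E)))
        * f (ix ! j) v) =
      (\<Prod>j<k. (1 + \<sigma> ! j) / 2 * lam (ix ! j) +
        (1 - \<sigma> ! j) / 2 * lambda_star n d lam (ix ! j)) * F ix a"
    (is "prod ?l _ = prod ?r _ * _")
    if a: "a \<in> ?L" and ix: "ix \<in> index_tuples n k" and \<sigma>: "\<sigma> \<in> sign_vectors k t" for a ix \<sigma>
  proof -
    have aj: "a ! j \<in> ?V" if "j < k" for j
      using a that nth_mem[of j a] by (auto simp: SGP_verts_def simp del: nth_mem)
    \<comment> \<open>The eigenvalue equation evaluates the edge sums; only the sum for the complete
      bipartite graph remains.\<close>
    have expand: "?l j = (1 + \<sigma> ! j) / 2 * (lam (ix ! j) * f (ix ! j) (a ! j)) +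
        (1 - \<sigma> ! j) / 2 * ((\<Sum>v\<in>?V. of_bool ((a ! j \<in> X) \<noteq> (v \<in> X)) * f (ix ! j) v) -
          lam (ix ! j) * f (ix ! j) (a ! j))" if "j < k" for j
      unfolding eig[OF ix_nth[OF ix that] aj[OF that], symmetric]
      by (simp only: sum_distrib_left sum.distrib[symmetric] sum_subtractf[symmetric])
        (simp add: algebra_simps)
    show ?thesis
    proof (cases "n = 1")
      case False
      have "?l j = ?r j * f (ix ! j) (a ! j)" if "j < k" for j
      proof -
        have K: "(\<Sum>v\<in>?V. of_bool ((a ! j \<in> X) \<noteq> (v \<in> X)) * f (ix ! j) v) =
            (lam (ix ! j) + lambda_star n d lam (ix ! j)) * f (ix ! j) (a ! j)"
          by (rule opposite_sides_sum_eigenfunction[where f = f,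
              OF bip conn reg card False lam eig orth ix_nth[OF ix that] aj[OF that]])
        show ?thesis
          unfolding expand[OF that] K by (simp add: distrib_right mult.assoc)
      qed
      then show ?thesis by (simp add: F_def prod.distrib)
    next
      \<comment> \<open>For one vertex the two special cases of \<open>lambda_star\<close> collide and its value is wrong, but
        \<open>lam 1 = 0\<close> and each sign vector has an entry 1, so both products vanish.\<close>
      case True
      then have "lam 1 = 0" using lam by simp
      have "{j. j < k \<and> \<sigma> ! j = 1} \<noteq> {}"
        using \<sigma> \<open>1 \<le> t\<close> by (intro notI) (simp add: sign_vectors_def)
      then obtain j where j: "j < k" "\<sigma> ! j = 1" by auto
      moreover have "ix ! j = 1" using ix_nth[OF ix j(1)] True by simp
      ultimately have "?l j = 0" "?r j = 0"
        using expand[OF j(1)] \<open>lam 1 = 0\<close> by simp_all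
      then have "prod ?l {..<k} = 0" "prod ?r {..<k} = 0"
        using j(1) by (auto intro!: prod_zero)
      then show ?thesis by (simp only: mult_zero_left)
    qed
  qed
  have W_eig: "eigenvector (adjacency_mat (tuple_list k vs) (SGP_edges X Y E k t)) (W ix)
      (Lambda n d k t lam ix)" if ix: "ix \<in> index_tuples n k" for ix
    unfolding W_def eigenvector_vec_on_iff[OF dist_L] set_L
  proof (intro conjI ballI)
    show "\<exists>a\<in>?L. F ix a \<noteq> 0"
    proof (rule ccontr)
      assume "\<not> ?thesis"
      \<comment> \<open>A vanishing \<open>F ix\<close> would contradict the unit norm of
        \<open>W ix\<close>.\<close>
      then have "W ix \<bullet> W ix = 0"
        by (simp add: W_def scalar_prod_vec_on[OF dist_L] set_L)
      then show False using W_orth[OF ix ix] by simp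
    qed
  next
    fix a assume a: "a \<in> ?L"
    let ?M = "\<lambda>\<sigma> j v. (1 + \<sigma> ! j) / 2 * of_bool ({a ! j, v} \<in> E) +
        (1 - \<sigma> ! j) / 2 * (of_bool ((a ! j \<in> X) \<noteq> (v \<in> X)) - of_bool ({a ! j, v} \<in> E)) :: real"
    \<comment> \<open>Expand adjacency over sign vectors, exchange the sums, and factor the sum over
      tuples into sums over vertices, which \<open>factors\<close> evaluates.\<close>
    have "(\<Sum>b\<in>?L. of_bool ({a, b} \<in> SGP_edges X Y E k t) * F ix b) =
        (\<Sum>b\<in>?L. \<Sum>\<sigma>\<in>sign_vectors k t. \<Prod>j<k. ?M \<sigma> j (b ! j) * f (ix ! j) (b ! j))"
      by (rule sum.cong)
        (simp_all only: SGP_edge_indicator[OF bip a] F_def prod.distrib sum_distrib_right)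
    also have "\<dots> = (\<Sum>\<sigma>\<in>sign_vectors k t. \<Sum>b\<in>?L. \<Prod>j<k. ?M \<sigma> j (b ! j) * f (ix ! j) (b ! j))"
      by (rule sum.swap)
    also have "\<dots> = (\<Sum>\<sigma>\<in>sign_vectors k t. \<Prod>j<k. \<Sum>v\<in>?V. ?M \<sigma> j v * f (ix ! j) v)"
      unfolding SGP_verts_def by (intro sum.cong refl sum_tuples_prod[OF fin])
    also have "\<dots> = Lambda n d k t lam ix * F ix a"
      unfolding Lambda_def sum_distrib_right
      by (intro sum.cong refl factors[OF a ix])
    finally show "(\<Sum>b\<in>?L. of_bool ({a, b} \<in> SGP_edges X Y E k t) * F ix b) =
        Lambda n d k t lam ix * F ix a" .
  qed
  \<comment> \<open>A repetition-free list of all index tuples; its length \<open>n ^ k\<close> is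
    the dimension of the matrix, as the spectrum lemma demands.\<close>
  define xs where "xs = tuple_list k [1..<Suc n]"
  have xs: "set xs = index_tuples n k" "distinct xs" "length xs = length (tuple_list k vs)"
    unfolding xs_def
    by (simp_all add: set_tuple_list index_tuples_def atLeastLessThanSuc_atLeastAtMost
        distinct_tuple_list length_tuple_list len del: upt_Suc)
  have "spectrum_mset (adjacency_mat (tuple_list k vs) (SGP_edges X Y E k t)) =
      image_mset (Lambda n d k t lam) (mset xs)"
    by (rule spectrum_mset_orthonormal_eigenvectors[of _ _ W])
      (use adjacency_mat_carrier xs W_eig W_orth in auto)
  also have "mset xs = mset_set (index_tuples n k)"
    using mset_set_set[OF xs(2)] xs(1) by simp
  finally show ?thesis using W_eig W by simp
qed

end
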